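(* Let $n\ge1$, let $\xi$ be a random vector uniformly distributed over the unit $l_\infty$-norm ball $Q=[-1,1]^n$, and let $g(x)=\sum_{i=1}^n x_i$ (so the true maximum of $g$ on $Q$ is $n$). Let $p\in(0,1)$ and $\delta\in(0,1)$ with $\delta\le 1/n$. Then the minimal sample size $N_{\min}$ that guarantees, with probability at least $p$, that the empirical maximum of $g$ is an at least $\delta$-accurate estimate of the true maximum is $$ N_{\min}=\left\lceil\frac{\ln(1-p)}{\ln\bigl(1-\frac{n^n\delta^n}{2^n\,n!}\bigr)}\right\rceil . $$ Moreover, for small $\delta$ and large $n$, $$ N_{\min}>-\frac{\sqrt{2\pi n}}{(\delta e/2)^n}\,\ln(1-p); $$ that is, for every $p\in(0,1)$ there is $n_0$ such that for every $n\ge n_0$ there is $\delta_0>0$ such that this inequality holds for all $\delta\in(0,\delta_0)$.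
   Context: For a positive integer $N$, let $\xi^{(1)},\dots,\xi^{(N)}$ be independent copies of $\xi$ (a multisample of size $N$). The empirical maximum is $\eta=\max_{1\le i\le N}g(\xi^{(i)})$. With $\eta^*=\max_{x\in Q}g(x)$ the true maximum, $\eta$ is an at least $\delta$-accurate estimate of $\eta^*$ if $(\eta^*-\eta)/\eta^*\le\delta$. Thus $N_{\min}$ is the smallest positive integer $N$ for which this event has probability at least $p$. Here $e$ is the base of the natural logarithm. *)

theory Defs
  imports "HOL-Probability.Probability"
begin

text \<open>Vectors in \<open>\<real>\<^sup>n\<close> are extensional functions on \<open>{..<n}\<close>, so that \<open>n\<close> can be quantified over
  inside a statement.\<close>

abbreviation borel_vec :: "nat \<Rightarrow> (nat \<Rightarrow> real) measure" where
  "borel_vec n \<equiv> (\<Pi>\<^sub>M i\<in>{..<n}. lborel)"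

definition linf_ball :: "nat \<Rightarrow> (nat \<Rightarrow> real) set" where
  "linf_ball n = (\<Pi>\<^sub>E i\<in>{..<n}. {-1..1})"

definition coord_sum :: "nat \<Rightarrow> (nat \<Rightarrow> real) \<Rightarrow> real" where
  "coord_sum n x = (\<Sum>i<n. x i)"

definition uniform_on_ball :: "nat \<Rightarrow> (nat \<Rightarrow> real) measure" where
  "uniform_on_ball n = uniform_measure (borel_vec n) (linf_ball n)"

text \<open>An infinite sequence of independent copies of a random element with law \<open>\<mu>\<close>; its first \<open>N\<close>
  members are a multisample of size \<open>N\<close>.\<close>

definition iid_sequence :: "'a measure \<Rightarrow> 'b measure \<Rightarrow> (nat \<Rightarrow> 'a \<Rightarrow> 'b) \<Rightarrow> bool" where
  "iid_sequence M \<mu> X \<longleftrightarrow>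
     prob_space M \<and> prob_space.indep_vars M (\<lambda>_. \<mu>) X UNIV \<and> (\<forall>i. distr M \<mu> (X i) = \<mu>)"

definition empirical_max :: "('b \<Rightarrow> real) \<Rightarrow> (nat \<Rightarrow> 'a \<Rightarrow> 'b) \<Rightarrow> nat \<Rightarrow> 'a \<Rightarrow> real" where
  "empirical_max g X N \<omega> = Max ((\<lambda>i. g (X i \<omega>)) ` {..<N})"

definition true_max :: "('b \<Rightarrow> real) \<Rightarrow> 'b set \<Rightarrow> real" where
  "true_max g Q = (GREATEST y. y \<in> g ` Q)"

definition accurate_estimate :: "real \<Rightarrow> real \<Rightarrow> real \<Rightarrow> bool" where
  "accurate_estimate \<delta> \<eta>_true \<eta> \<longleftrightarrow> (\<eta>_true - \<eta>) / \<eta>_true \<le> \<delta>"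

definition sufficient_size ::
    "'a measure \<Rightarrow> (nat \<Rightarrow> 'a \<Rightarrow> 'b) \<Rightarrow> ('b \<Rightarrow> real) \<Rightarrow> 'b set \<Rightarrow> real \<Rightarrow> real \<Rightarrow> nat \<Rightarrow> bool" where
  "sufficient_size M X g Q \<delta> p N \<longleftrightarrow>
     N > 0 \<and>
     measure M {\<omega> \<in> space M. accurate_estimate \<delta> (true_max g Q) (empirical_max g X N \<omega>)} \<ge> p"

definition N_min ::
    "'a measure \<Rightarrow> (nat \<Rightarrow> 'a \<Rightarrow> 'b) \<Rightarrow> ('b \<Rightarrow> real) \<Rightarrow> 'b set \<Rightarrow> real \<Rightarrow> real \<Rightarrow> nat" where
  "N_min M X g Q \<delta> p = (LEAST N. sufficient_size M X g Q \<delta> p N)"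

end

theory Submission
  imports Defs
begin

text \<open>The substitution \<open>y = 1 - x\<close> turns the set of accurate points \<open>g(x) \<ge> n - n \<delta>\<close> into the simplex
  \<open>y \<ge> 0\<close>, \<open>\<Sum>y \<le> n \<delta>\<close>; since \<open>n \<delta> \<le> 1\<close>, the constraints \<open>y \<le> 2\<close> are automatic, so a single sample is
  accurate with probability \<open>q = (n \<delta>)^n / (2^n n!)\<close>. All \<open>N\<close> samples miss with probability
  \<open>(1 - q)^N\<close>, which gives the formula for the minimal \<open>N\<close>. For the asymptotic bound,
  \<open>- ln (1 - q) \<le> q / (1 - q)\<close> is only slightly larger than \<open>q\<close>, and the strict inequality
  \<open>n! > sqrt (2 \<pi> n) (n/e)^n\<close> leaves room to absorb the difference once \<open>\<delta>\<close> is small.\<close>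

section \<open>Strict Stirling lower bound for the factorial\<close>

text \<open>The difference of the two sides vanishes at 1 and has derivative
  \<open>(y - 1)\<^sup>2 / (y * (y + 1)\<^sup>2)\<close>, positive beyond 1.\<close>

lemma ln_strict_lower_bound:
  fixes x :: real
  assumes "x > 1"
  shows "2 * (x - 1) / (x + 1) < ln x"
proof -
  define f where "f = (\<lambda>x::real. ln x - 2 * (x - 1) / (x + 1))"
  have "f 1 < f x"
  proof (rule DERIV_pos_imp_increasing_open[OF assms])
    fix y :: real assume y: "1 < y" "y < x"
    have "1 / y - (2 * (y + 1) - 2 * (y - 1)) / ((y + 1) * (y + 1)) = (y - 1)\<^sup>2 / (y * (y + 1)\<^sup>2)"
      using y by (simp add: divide_simps) (simp add: power2_eq_square algebra_simps)
    moreover have "(f has_real_derivative 1 / y - (2 * (y + 1) - 2 * (y - 1)) / ((y + 1) * (y + 1))) (at y)"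
      unfolding f_def using y
      by (intro DERIV_diff DERIV_ln_divide DERIV_divide) (auto intro!: derivative_eq_intros)
    moreover have "(y - 1)\<^sup>2 / (y * (y + 1)\<^sup>2) > 0"
      using y by simp
    ultimately show "\<exists>d. (f has_real_derivative d) (at y) \<and> 0 < d" by metis
  next
    show "continuous_on {1..x} f"
      unfolding f_def by (auto intro!: continuous_intros)
  qed
  then show ?thesis by (simp add: f_def)
qed

text \<open>This closed form turns the limit of Wallis' product into information about
  factorials.\<close>

lemma wallis_prod_eq:
  "(\<Prod>k=1..n. 4 * real k ^ 2 / (4 * real k ^ 2 - 1)) =
     (2 ^ n * fact n) ^ 4 / (fact (2 * n) ^ 2 * (2 * real n + 1))"
proof (induction n)
  case (Suc n)
  \<comment> \<open>With \<open>P\<close>, \<open>F\<close>, \<open>G\<close>, \<open>x\<close>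
    standing for \<open>2 ^ n\<close>, \<open>fact n\<close>, \<open>fact (2 * n)\<close>,
    \<open>real n\<close>, the induction step reduces to polynomial identities.\<close>
  have step: "(P * F) ^ 4 / (G\<^sup>2 * (2 * x + 1)) * (4 * (x + 1)\<^sup>2 / ((2 * x + 1) * (2 * x + 3))) =
      (2 * P * ((x + 1) * F)) ^ 4 / (((2 * x + 2) * (2 * x + 1) * G)\<^sup>2 * (2 * x + 3))"
    if "x \<ge> 0" "G > 0" for x P F G :: real
  proof -
    have "(2 * P * ((x + 1) * F)) ^ 4 = (P * F) ^ 4 * (4 * (x + 1)\<^sup>2) * (2 * x + 2)\<^sup>2"
      by algebra
    moreover have "((2 * x + 2) * (2 * x + 1) * G)\<^sup>2 * (2 * x + 3) =
        G\<^sup>2 * (2 * x + 1) * ((2 * x + 1) * (2 * x + 3)) * (2 * x + 2)\<^sup>2"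
      by algebra
    ultimately show ?thesis using that by simp
  qed
  have 1: "real (Suc n) = real n + 1" "4 * (real n + 1)\<^sup>2 - 1 = (2 * real n + 1) * (2 * real n + 3)"
    "2 * (real n + 1) + 1 = 2 * real n + 3"
    by (simp_all add: power2_eq_square algebra_simps)
  have 2: "(fact (2 * Suc n) :: real) = (2 * real n + 2) * (2 * real n + 1) * fact (2 * n)"
    "(fact (Suc n) :: real) = (real n + 1) * fact n"
    by (simp_all add: algebra_simps)
  have "(\<Prod>k=1..Suc n. 4 * real k ^ 2 / (4 * real k ^ 2 - 1)) =
      (\<Prod>k=1..n. 4 * real k ^ 2 / (4 * real k ^ 2 - 1)) * (4 * real (Suc n) ^ 2 / (4 * real (Suc n) ^ 2 - 1))"
    by simp
  then show ?case
    unfolding Suc.IH 1 2 power_Suc[of 2 n] by (simp only: step fact_gt_zero of_nat_0_le_iff)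
qed simp

text \<open>For positive \<open>n\<close> this is the logarithm of n! / (sqrt n * (n/e)^n), the
  quotient that tends to sqrt (2 pi).\<close>

definition stirling_ln :: "nat \<Rightarrow> real" where
  "stirling_ln n = ln (fact n) - (real n + 1 / 2) * ln (real n) + real n"

lemma stirling_ln_diff:
  assumes "n > 0"
  shows "stirling_ln n - stirling_ln (Suc n) = (real n + 1 / 2) * (ln (real n + 1) - ln (real n)) - 1"
proof -
  have "ln (fact (Suc n) :: real) = ln (real n + 1) + ln (fact n)"
    using ln_mult[of "real n + 1" "fact n"] by (simp add: algebra_simps)
  then show ?thesis
    by (simp add: stirling_ln_def algebra_simps del: fact_Suc)
qed

text \<open>The strict logarithm bound at x = (n+1)/n reads ln ((n+1)/n) > 1/(n + 1/2), which makes
  the difference of consecutive terms positive.\<close>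

lemma stirling_ln_Suc_less:
  assumes "n > 0"
  shows "stirling_ln (Suc n) < stirling_ln n"
proof -
  have "2 / (2 * real n + 1) = 2 * ((real n + 1) / real n - 1) / ((real n + 1) / real n + 1)"
    using assms by (simp add: field_simps)
  also have "\<dots> < ln ((real n + 1) / real n)"
    using assms by (intro ln_strict_lower_bound) simp
  also have "\<dots> = ln (real n + 1) - ln (real n)"
    using assms by (simp add: ln_div)
  finally show ?thesis
    using stirling_ln_diff[OF assms] assms by (simp add: field_simps)
qed

text \<open>The trapezoid rule overestimates the integral of the convex function 1/x over [n, n+1];
  the resulting bound 1/(4n(n+1)) telescopes.\<close>

lemma stirling_ln_diff_le:
  assumes "n > 0"
  shows "stirling_ln n - stirling_ln (Suc n) \<le> 1 / (4 * real n) - 1 / (4 * real (Suc n))"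
proof -
  have "ln (real n + 1) - ln (real n) \<le> (inverse (real n) + inverse (real n + 1)) / 2"
    using assms ln_inverse_approx_le[of "real n" 1] by simp
  then have "stirling_ln n - stirling_ln (Suc n)
      \<le> (real n + 1 / 2) * ((inverse (real n) + inverse (real n + 1)) / 2) - 1"
    unfolding stirling_ln_diff[OF assms] by (intro diff_right_mono mult_left_mono) auto
  also have "\<dots> = 1 / (4 * real n) - 1 / (4 * real (Suc n))"
    using assms by (simp add: divide_simps) (simp add: algebra_simps)
  finally show ?thesis .
qed

text \<open>By the previous lemma \<open>stirling_ln n - 1 / (4 n)\<close> increases, which bounds \<open>stirling_ln\<close> from below.\<close>

lemma stirling_ln_convergent: "convergent (\<lambda>n. stirling_ln (Suc n))"
proof -
  \<comment> \<open>3/4 is the value at \<open>n = 0\<close>, where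
    \<open>stirling_ln 1 = 1\<close>.\<close>
  have "3 / 4 \<le> stirling_ln (Suc n) - 1 / (4 * real (Suc n))" for n
  proof (induction n)
    case 0 show ?case by (simp add: stirling_ln_def)
  next
    case (Suc n) then show ?case
      using stirling_ln_diff_le[of "Suc n"] by linarith
  qed
  then have "0 \<le> stirling_ln (Suc n)" for n
    using order_trans[of "3/4" "stirling_ln (Suc n) - 1 / (4 * real (Suc n))" "stirling_ln (Suc n)"]
    by (smt (verit) divide_nonneg_nonneg of_nat_0_le_iff)
  moreover have "decseq (\<lambda>n. stirling_ln (Suc n))"
    by (intro decseq_SucI less_imp_le stirling_ln_Suc_less) simp
  ultimately show ?thesis
    by (metis decseq_convergent convergent_def)
qed

text \<open>The combination on the left tends to twice the limit of \<open>stirling_ln\<close>; Wallis' product evaluates it.\<close>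

lemma stirling_ln_double:
  assumes "n > 0"
  shows "4 * stirling_ln n - 2 * stirling_ln (2 * n) =
    ln (\<Prod>k=1..n. 4 * real k ^ 2 / (4 * real k ^ 2 - 1)) + ln ((2 * real n + 1) / real n) + ln 2"
proof -
  have "ln ((2 ^ n * fact n) ^ 4 / (fact (2 * n) ^ 2 * (2 * real n + 1))) =
     4 * (real n * ln 2 + ln (fact n)) - (2 * ln (fact (2 * n)) + ln (2 * real n + 1))"
    by (simp add: ln_div ln_mult ln_realpow)
  then show ?thesis
    unfolding wallis_prod_eq stirling_ln_def using assms
    by (simp add: ln_div ln_mult algebra_simps)
qed

lemma stirling_ln_tendsto: "(\<lambda>n. stirling_ln (Suc n)) \<longlonglongrightarrow> ln (2 * pi) / 2"
proof -
  obtain l where l: "(\<lambda>n. stirling_ln (Suc n)) \<longlonglongrightarrow> l"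
    using stirling_ln_convergent by (auto simp: convergent_def)
  then have l': "stirling_ln \<longlonglongrightarrow> l"
    by (simp add: filterlim_sequentially_Suc)
  have "filterlim (\<lambda>n::nat. 2 * n) sequentially sequentially"
    by (intro filterlim_subseq strict_monoI) simp
  then have "(\<lambda>n. 4 * stirling_ln n - 2 * stirling_ln (2 * n)) \<longlonglongrightarrow> 4 * l - 2 * l"
    by (intro tendsto_intros l' filterlim_compose[OF l'])
  \<comment> \<open>Wallis' product contributes \<open>ln (pi / 2)\<close>, the quotient (2n+1)/n
    contributes one \<open>ln 2\<close>, and the other is the constant term.\<close>
  moreover have "(\<lambda>n. 4 * stirling_ln n - 2 * stirling_ln (2 * n)) \<longlonglongrightarrow> ln (pi / 2) + ln 2 + ln 2"
  proof (rule Lim_transform_eventually)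
    have "(\<lambda>n. (2 * real n + 1) / real n) \<longlonglongrightarrow> 2" by real_asymp
    then show "(\<lambda>n. ln (\<Prod>k=1..n. 4 * real k ^ 2 / (4 * real k ^ 2 - 1))
        + ln ((2 * real n + 1) / real n) + ln 2) \<longlonglongrightarrow> ln (pi / 2) + ln 2 + ln 2"
      by (intro tendsto_intros wallis) auto
  qed (use eventually_gt_at_top[of 0] in eventually_elim, simp only: stirling_ln_double)
  ultimately have "2 * l = ln (pi / 2) + ln 2 + ln 2"
    using LIMSEQ_unique by fastforce
  then have "l = ln (2 * pi) / 2"
    by (simp add: ln_div ln_mult)
  with l show ?thesis by simp
qed

lemma stirling_lower_bound:
  assumes "n > 0"
  shows "sqrt (2 * pi * real n) * (real n / exp 1) ^ n < fact n"
proof -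
  obtain m where m: "n = Suc m" using assms gr0_implies_Suc by blast
  have dec: "decseq (\<lambda>n. stirling_ln (Suc n))"
    by (intro decseq_SucI less_imp_le stirling_ln_Suc_less) simp
  have "ln (2 * pi) / 2 \<le> stirling_ln (Suc (Suc m))"
    by (rule decseq_ge[OF dec stirling_ln_tendsto])
  \<comment> \<open>A decreasing sequence is only weakly above its limit; comparing with the next
    term first makes the bound strict.\<close>
  also have "\<dots> < stirling_ln n"
    unfolding m by (intro stirling_ln_Suc_less) simp
  finally have "ln (2 * pi) / 2 + (real n + 1 / 2) * ln (real n) - real n < ln (fact n)"
    by (simp add: stirling_ln_def)
  moreover have "ln (sqrt (2 * pi * real n) * (real n / exp 1) ^ n) =
      ln (2 * pi) / 2 + (real n + 1 / 2) * ln (real n) - real n"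
    using assms by (simp add: ln_mult ln_sqrt ln_realpow ln_div algebra_simps add_divide_distrib)
  ultimately have "ln (sqrt (2 * pi * real n) * (real n / exp 1) ^ n) < ln (fact n)" by simp
  then show ?thesis using assms by (subst (asm) ln_less_cancel_iff) auto
qed

section \<open>Volume of the corner of the ball where the coordinate sum is large\<close>

lemma emeasure_lborel_reflect:
  fixes A :: "real set"
  assumes "A \<in> sets borel"
  shows "emeasure lborel ((\<lambda>x. a - x) -` A) = emeasure lborel A"
proof -
  have "lborel = distr lborel borel (\<lambda>x::real. a - x)"
    using lborel_real_affine[of "-1" a] by (simp add: density_1)
  then have "emeasure lborel A = emeasure (distr lborel borel (\<lambda>x. a - x)) A" by simp
  also have "\<dots> = emeasure lborel ((\<lambda>x. a - x) -` A)"
    using assms by (subst emeasure_distr) auto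
  finally show ?thesis by simp
qed

text \<open>A product measure is determined by its values on boxes, and the preimage of a box is the
  box of reflected sides, so the one-dimensional invariance suffices.\<close>

lemma distr_PiM_lborel_reflect:
  fixes a :: real
  assumes "finite I"
  shows "distr (\<Pi>\<^sub>M i\<in>I. lborel) (\<Pi>\<^sub>M i\<in>I. lborel) (\<lambda>x. \<lambda>i\<in>I. a - x i) = (\<Pi>\<^sub>M i\<in>I. lborel)"
proof -
  interpret product_sigma_finite "\<lambda>_. lborel :: real measure" by standard
  show ?thesis
  proof (rule PiM_eqI[OF assms])
    fix A :: "'a \<Rightarrow> real set" assume A: "\<And>i. i \<in> I \<Longrightarrow> A i \<in> sets lborel"
    have "emeasure (distr (\<Pi>\<^sub>M i\<in>I. lborel) (\<Pi>\<^sub>M i\<in>I. lborel) (\<lambda>x. \<lambda>i\<in>I. a - x i)) (Pi\<^sub>E I A) =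
        emeasure (\<Pi>\<^sub>M i\<in>I. lborel) ((\<lambda>x. \<lambda>i\<in>I. a - x i) -` Pi\<^sub>E I A \<inter> space (\<Pi>\<^sub>M i\<in>I. lborel))"
      using A assms by (intro emeasure_distr sets_PiM_I_finite) auto
    also have "(\<lambda>x. \<lambda>i\<in>I. a - x i) -` Pi\<^sub>E I A \<inter> space (\<Pi>\<^sub>M i\<in>I. lborel) =
        Pi\<^sub>E I (\<lambda>i. (\<lambda>x. a - x) -` A i)"
      by (auto simp: space_PiM PiE_iff)
    also have "emeasure (\<Pi>\<^sub>M i\<in>I. lborel) \<dots> = (\<Prod>i\<in>I. emeasure lborel ((\<lambda>x. a - x) -` A i))"
    proof (rule emeasure_PiM[OF assms])
      fix i assume "i \<in> I"
      then have "A i \<in> sets borel" using A by simp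
      then have "(\<lambda>x. a - x) -` A i \<inter> space borel \<in> sets borel"
        by (intro measurable_sets[of _ borel borel]) auto
      then show "(\<lambda>x. a - x) -` A i \<in> sets lborel" by simp
    qed
    also have "\<dots> = (\<Prod>i\<in>I. emeasure lborel (A i))"
      using A by (intro prod.cong refl emeasure_lborel_reflect) simp
    finally show "emeasure (distr (\<Pi>\<^sub>M i\<in>I. lborel) (\<Pi>\<^sub>M i\<in>I. lborel) (\<lambda>x. \<lambda>i\<in>I. a - x i)) (Pi\<^sub>E I A)
        = (\<Prod>i\<in>I. emeasure lborel (A i))" .
  qed simp
qed

lemma coord_sum_measurable [measurable]: "coord_sum n \<in> borel_measurable (borel_vec n)"
  unfolding coord_sum_def by measurable

lemma linf_ball_sets [measurable]: "linf_ball n \<in> sets (borel_vec n)"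
  unfolding linf_ball_def by (intro sets_PiM_I_finite) auto

lemma emeasure_linf_ball: "emeasure (borel_vec n) (linf_ball n) = 2 ^ n"
proof -
  interpret product_sigma_finite "\<lambda>_. lborel :: real measure" by standard
  show ?thesis unfolding linf_ball_def by (subst emeasure_PiM) auto
qed

lemma emeasure_ball_corner:
  assumes "0 \<le> t" "t \<le> 2"
  shows "emeasure (borel_vec n) (linf_ball n \<inter> {x \<in> space (borel_vec n). real n - t \<le> coord_sum n x})
    = ennreal (t ^ n / fact n)"
proof -
  let ?C = "linf_ball n \<inter> {x \<in> space (borel_vec n). real n - t \<le> coord_sum n x}"
  let ?r = "\<lambda>x::nat \<Rightarrow> real. \<lambda>i\<in>{..<n}. 1 - x i"
  \<comment> \<open>A nonnegative coordinate is at most the whole sum, hence at most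
    \<open>t\<close>. After reflection this is the constraint that the original coordinate is at
    least -1.\<close>
  have le: "x i \<le> 2" if "\<forall>j<n. 0 \<le> x j" "(\<Sum>j<n. x j) \<le> t" "i < n" for x :: "nat \<Rightarrow> real" and i
    using member_le_sum[of i "{..<n}" x] that assms by force
  have "emeasure (borel_vec n) ?C = emeasure (distr (borel_vec n) (borel_vec n) ?r) ?C"
    by (subst distr_PiM_lborel_reflect) auto
  also have "\<dots> = emeasure (borel_vec n) (?r -` ?C \<inter> space (borel_vec n))"
    by (rule emeasure_distr) measurable
  also have "?r -` ?C \<inter> space (borel_vec n) =
      {x. (\<forall>i\<in>{..<n}. 0 \<le> x i) \<and> sum x {..<n} \<le> t} \<inter> space (borel_vec n)"
    using le by (auto simp: linf_ball_def space_PiM PiE_iff coord_sum_def sum_subtractf algebra_simps)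
  \<comment> \<open>What remains is the standard simplex scaled by \<open>t\<close>.\<close>
  also have "emeasure (borel_vec n) \<dots> = ennreal (t ^ n / fact n)"
    using emeasure_std_simplex_aux[of "{..<n}" t] assms by simp
  finally show ?thesis .
qed

lemma measure_uniform_corner:
  assumes "0 \<le> t" "t \<le> 2"
  shows "measure (uniform_on_ball n) {x \<in> space (borel_vec n). real n - t \<le> coord_sum n x}
    = t ^ n / (2 ^ n * fact n)"
proof -
  have "emeasure (uniform_on_ball n) {x \<in> space (borel_vec n). real n - t \<le> coord_sum n x}
      = ennreal (t ^ n / fact n) / ennreal (2 ^ n)"
    unfolding uniform_on_ball_def
    by (subst emeasure_uniform_measure)
       (simp_all add: emeasure_ball_corner[OF assms] emeasure_linf_ball flip: ennreal_power)
  also have "\<dots> = ennreal (t ^ n / (2 ^ n * fact n))"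
    using assms by (subst divide_ennreal) (auto simp: mult.commute)
  finally show ?thesis
    using assms by (simp add: measure_def)
qed

section \<open>Accuracy probability of the empirical maximum\<close>

lemma true_max_coord_sum: "true_max (coord_sum n) (linf_ball n) = real n"
  unfolding true_max_def
proof (rule Greatest_equality)
  have "(\<lambda>i\<in>{..<n}. 1) \<in> linf_ball n" "coord_sum n (\<lambda>i\<in>{..<n}. 1) = real n"
    by (auto simp: linf_ball_def coord_sum_def)
  then show "real n \<in> coord_sum n ` linf_ball n" by force
next
  fix y assume "y \<in> coord_sum n ` linf_ball n"
  then obtain x where x: "x \<in> linf_ball n" "y = coord_sum n x" by auto
  then have "coord_sum n x \<le> (\<Sum>i<n. 1)"
    unfolding coord_sum_def linf_ball_def by (intro sum_mono) (auto simp: PiE_iff)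
  with x show "y \<le> real n" by simp
qed

lemma prob_empirical_max_accurate:
  assumes iid: "iid_sequence M (uniform_on_ball n) X"
    and "n \<ge> 1" "N \<ge> 1" "0 < \<delta>" "\<delta> \<le> 1 / real n"
  shows "measure M {\<omega> \<in> space M. accurate_estimate \<delta> (real n) (empirical_max (coord_sum n) X N \<omega>)}
    = 1 - (1 - real n ^ n * \<delta> ^ n / (2 ^ n * fact n)) ^ N"
proof -
  interpret prob_space M using iid by (simp add: iid_sequence_def)
  let ?U = "uniform_on_ball n"
  define q where "q = real n ^ n * \<delta> ^ n / (2 ^ n * fact n)"
  have [simp]: "space ?U = space (borel_vec n)" and sets_U: "sets ?U = sets (borel_vec n)"
    by (simp_all add: uniform_on_ball_def)
  have ind: "indep_vars (\<lambda>_. ?U) X UNIV" and law: "\<And>i. distr M ?U (X i) = ?U"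
    using iid by (auto simp: iid_sequence_def)
  then have X [measurable]: "X i \<in> measurable M ?U" for i
    by (auto simp: indep_vars_def)
  \<comment> \<open>\<open>G\<close> holds the points accurate on their own, the corner with
    \<open>t = n * \<delta>\<close>; \<open>B\<close> holds the misses.\<close>
  define G where "G = {x \<in> space (borel_vec n). real n - real n * \<delta> \<le> coord_sum n x}"
  define B where "B = space (borel_vec n) - G"
  have G: "G \<in> sets ?U" unfolding G_def sets_U by measurable
  then have B: "B \<in> sets ?U" unfolding B_def using sets.compl_sets[OF G] by simp
  have UG: "measure ?U G = q"
    unfolding G_def q_def using assms
    by (subst measure_uniform_corner) (auto simp: field_simps power_mult_distrib)
  \<comment> \<open>The uniform law is a probability measure because it is the law of
    \<open>X 0\<close>.\<close>
  interpret U: prob_space ?U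
    using prob_space_distr[OF X[of 0]] law by simp
  have "measure ?U B = 1 - q"
    unfolding B_def using U.prob_compl[OF G] UG by simp
  then have XB: "prob (X i -` B \<inter> space M) = 1 - q" for i
    using measure_distr[OF X[of i] B] law by simp
  have acc: "accurate_estimate \<delta> (real n) \<eta> \<longleftrightarrow> real n - real n * \<delta> \<le> \<eta>" for \<eta>
    using assms by (auto simp: accurate_estimate_def field_simps)
  have ne: "{..<N} \<noteq> {}" using \<open>N \<ge> 1\<close> by (simp add: lessThan_empty_iff)
  have "{\<omega> \<in> space M. accurate_estimate \<delta> (real n) (empirical_max (coord_sum n) X N \<omega>)}
      = space M - (\<Inter>i<N. X i -` B \<inter> space M)"
  proof -
    have sp: "X i \<omega> \<in> space (borel_vec n)" if "\<omega> \<in> space M" for i \<omega>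
      using measurable_space[OF X that] by simp
    \<comment> \<open>A maximum over a nonempty finite set reaches the threshold iff some member
      does, so failure means that all samples lie in \<open>B\<close>.\<close>
    have "accurate_estimate \<delta> (real n) (empirical_max (coord_sum n) X N \<omega>) \<longleftrightarrow> (\<exists>i<N. X i \<omega> \<in> G)"
      if "\<omega> \<in> space M" for \<omega>
      unfolding acc empirical_max_def G_def using ne sp[OF that] by (subst Max_ge_iff) auto
    then show ?thesis
      unfolding B_def using sp by blast
  qed
  also have "prob \<dots> = 1 - prob (\<Inter>i<N. X i -` B \<inter> space M)"
    using ne B by (intro prob_compl sets.finite_INT measurable_sets[OF X]) auto
  also have "prob (\<Inter>i<N. X i -` B \<inter> space M) = (\<Prod>i<N. prob (X i -` B \<inter> space M))"
    using ne B by (intro indep_varsD[OF ind]) auto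
  finally show ?thesis by (simp add: XB q_def)
qed

text \<open>As \<open>n * \<delta>\<close> is at most 1, so is its power at most itself, and the
  denominator is at least 2. The bound linear in \<delta> gives \<open>q < 1\<close> and, later, an
  explicit threshold for \<delta>.\<close>

lemma corner_prob_bounds:
  assumes "n \<ge> 1" "0 < \<delta>" "\<delta> \<le> 1 / real n"
  shows "0 < real n ^ n * \<delta> ^ n / (2 ^ n * fact n)"
    and "real n ^ n * \<delta> ^ n / (2 ^ n * fact n) < real n * \<delta>"
proof -
  have nd: "0 < real n * \<delta>" "real n * \<delta> \<le> 1" using assms by (auto simp: field_simps)
  show "0 < real n ^ n * \<delta> ^ n / (2 ^ n * fact n)" using assms by simp
  have "(2::real) * 1 \<le> 2 ^ n * fact n"
    using assms self_le_power[of "2::real" n] by (intro mult_mono) auto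
  then have "(real n * \<delta>) ^ n / (2 ^ n * fact n) < (real n * \<delta>) ^ n"
    using nd by (simp add: divide_less_eq)
  also have "\<dots> \<le> (real n * \<delta>) ^ 1"
    using nd assms by (intro power_decreasing) auto
  finally show "real n ^ n * \<delta> ^ n / (2 ^ n * fact n) < real n * \<delta>"
    by (simp add: power_mult_distrib)
qed

section \<open>The minimal sample size as a ceiling\<close>

lemma sufficient_size_iff:
  assumes iid: "iid_sequence M (uniform_on_ball n) X"
    and n: "n \<ge> 1" and p: "0 < p" "p < 1" and \<delta>: "0 < \<delta>" "\<delta> \<le> 1 / real n"
  shows "sufficient_size M X (coord_sum n) (linf_ball n) \<delta> p N \<longleftrightarrow>
    ln (1 - p) / ln (1 - real n ^ n * \<delta> ^ n / (2 ^ n * fact n)) \<le> real N"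
proof -
  define q where "q = real n ^ n * \<delta> ^ n / (2 ^ n * fact n)"
  have "real n * \<delta> \<le> 1" using n \<delta> by (simp add: field_simps)
  then have q: "0 < q" "q < 1"
    using corner_prob_bounds[OF n \<delta>] unfolding q_def by (blast, linarith)
  then have lnq: "ln (1 - q) < 0" by simp
  show ?thesis
  proof (cases "N = 0")
    \<comment> \<open>Size 0 is insufficient by definition, in agreement with a positive quotient of
      logarithms.\<close>
    case True
    have "ln (1 - p) / ln (1 - q) > 0" using lnq p by (simp add: divide_neg_neg)
    with True show ?thesis by (simp add: sufficient_size_def q_def)
  next
    case False
    have "sufficient_size M X (coord_sum n) (linf_ball n) \<delta> p N \<longleftrightarrow> (1 - q) ^ N \<le> 1 - p"
      using False prob_empirical_max_accurate[OF iid n _ \<delta>, of N]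
      by (auto simp: sufficient_size_def true_max_coord_sum q_def)
    also have "\<dots> \<longleftrightarrow> ln ((1 - q) ^ N) \<le> ln (1 - p)"
      using q p by (subst ln_le_cancel_iff) auto
    \<comment> \<open>Dividing by the negative number \<open>ln (1 - q)\<close> reverses the
      inequality.\<close>
    also have "\<dots> \<longleftrightarrow> ln (1 - p) / ln (1 - q) \<le> real N"
      using q lnq by (simp add: ln_realpow neg_divide_le_eq)
    finally show ?thesis by (simp add: q_def)
  qed
qed

lemma N_min_eq:
  assumes "iid_sequence M (uniform_on_ball n) X"
    and "n \<ge> 1" "0 < p" "p < 1" "0 < \<delta>" "\<delta> \<le> 1 / real n"
  shows "sufficient_size M X (coord_sum n) (linf_ball n) \<delta> p
      (N_min M X (coord_sum n) (linf_ball n) \<delta> p)"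
    and "int (N_min M X (coord_sum n) (linf_ball n) \<delta> p) =
      \<lceil>ln (1 - p) / ln (1 - real n ^ n * \<delta> ^ n / (2 ^ n * fact n))\<rceil>"
proof -
  define r where "r = ln (1 - p) / ln (1 - real n ^ n * \<delta> ^ n / (2 ^ n * fact n))"
  note iff = sufficient_size_iff[OF assms, folded r_def]
  show suff: "sufficient_size M X (coord_sum n) (linf_ball n) \<delta> p
      (N_min M X (coord_sum n) (linf_ball n) \<delta> p)"
    unfolding N_min_def using real_arch_simple[of r] iff by (blast intro: LeastI_ex)
  \<comment> \<open>Since 0 is not a sufficient size, \<open>r\<close> is positive, so
    \<open>nat\<close> loses nothing on its ceiling.\<close>
  have "\<not> r \<le> real 0"
    using iff[of 0] by (simp add: sufficient_size_def)
  then have r: "0 < r" by simp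
  have "r \<le> real (nat \<lceil>r\<rceil>)" using r by linarith
  then have "N_min M X (coord_sum n) (linf_ball n) \<delta> p \<le> nat \<lceil>r\<rceil>"
    unfolding N_min_def by (intro Least_le) (simp add: iff)
  moreover have "nat \<lceil>r\<rceil> \<le> N_min M X (coord_sum n) (linf_ball n) \<delta> p"
    using suff by (simp add: iff ceiling_le_iff nat_le_iff)
  ultimately have "N_min M X (coord_sum n) (linf_ball n) \<delta> p = nat \<lceil>r\<rceil>" by simp
  then show "int (N_min M X (coord_sum n) (linf_ball n) \<delta> p) = \<lceil>r\<rceil>"
    using r by simp
qed

section \<open>Asymptotic lower bound on the minimal sample size\<close>

lemma N_min_lower_bound:
  fixes p :: real
  assumes n: "n \<ge> 1" and p: "0 < p" "p < 1"
  shows "\<exists>\<delta>0>0. \<forall>\<delta>. 0 < \<delta> \<and> \<delta> < \<delta>0 \<longrightarrow>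
    (\<forall>(M :: 'a measure) X. iid_sequence M (uniform_on_ball n) X \<longrightarrow>
      real (N_min M X (coord_sum n) (linf_ball n) \<delta> p) >
        - (sqrt (2 * pi * real n) / (\<delta> * exp 1 / 2) ^ n) * ln (1 - p))"
proof -
  \<comment> \<open>\<open>c\<close> measures the slack in Stirling's bound; it exceeds 1 and does
    not depend on \<delta>.\<close>
  define c where "c = fact n / (sqrt (2 * pi * real n) * (real n / exp 1) ^ n)"
  have c: "c > 1"
    using stirling_lower_bound[of n] n by (simp add: c_def)
  show ?thesis
  \<comment> \<open>Below this threshold \<open>q < n * \<delta> < 1 - 1 / c\<close>, which is what
    makes \<open>1 / (1 - q) < c\<close>.\<close>
  proof (intro exI[of _ "(1 - 1 / c) / real n"] conjI allI impI; (elim conjE)?)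
    show "(1 - 1 / c) / real n > 0" using n c by simp
  next
    fix \<delta> :: real and M :: "'a measure" and X
    assume \<delta>: "0 < \<delta>" "\<delta> < (1 - 1 / c) / real n" and iid: "iid_sequence M (uniform_on_ball n) X"
    define q where "q = real n ^ n * \<delta> ^ n / (2 ^ n * fact n)"
    have nd: "real n * \<delta> < 1 - 1 / c" using \<delta> n by (simp add: field_simps)
    have "1 - 1 / c < 1" using c by simp
    with nd have "real n * \<delta> < 1" by linarith
    then have \<delta>': "\<delta> \<le> 1 / real n" using n by (simp add: field_simps)
    have q: "0 < q" "q < 1 - 1 / c"
      using corner_prob_bounds[OF n \<delta>(1) \<delta>'] nd unfolding q_def by (blast, linarith)
    then have q1: "q < 1" using \<open>1 - 1 / c < 1\<close> by linarith
    have "- ln (1 - q) = ln (1 / (1 - q))" using q1 by (simp add: ln_div)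
    also have "\<dots> \<le> 1 / (1 - q) - 1" using q1 by (intro ln_le_minus_one) simp
    also have "\<dots> = q * (1 / (1 - q))" using q1 by (simp add: field_simps)
    also have "\<dots> < q * c"
      using q q1 c by (intro mult_strict_left_mono) (auto simp: field_simps)
    finally have lnq: "- ln (1 - q) < q * c" .
    \<comment> \<open>The powers of \<open>n\<close> and the factorials cancel in
      \<open>q * c\<close>, leaving
      \<open>(\<delta> * exp 1 / 2) ^ n / sqrt (2 * pi * n)\<close>.\<close>
    have "- (sqrt (2 * pi * real n) / (\<delta> * exp 1 / 2) ^ n) * ln (1 - p) = - ln (1 - p) / (q * c)"
      using n \<delta>(1) by (simp add: q_def c_def field_simps power_mult_distrib power_divide)
    also have "\<dots> < - ln (1 - p) / (- ln (1 - q))"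
      using lnq p q q1 c by (intro divide_strict_left_mono mult_pos_pos) auto
    also have "\<dots> \<le> real (N_min M X (coord_sum n) (linf_ball n) \<delta> p)"
      using N_min_eq(1)[OF iid n p \<delta>(1) \<delta>']
      by (subst (asm) sufficient_size_iff[OF iid n p \<delta>(1) \<delta>']) (simp add: q_def)
    finally show "real (N_min M X (coord_sum n) (linf_ball n) \<delta> p) >
      - (sqrt (2 * pi * real n) / (\<delta> * exp 1 / 2) ^ n) * ln (1 - p)" .
  qed
qed

theorem theorem5:
  shows "(\<forall>n::nat. \<forall>p::real. \<forall>\<delta>::real. n \<ge> 1 \<and> 0 < p \<and> p < 1 \<and> 0 < \<delta> \<and> \<delta> < 1 \<and> \<delta> \<le> 1 / real n \<longrightarrow>
            true_max (coord_sum n) (linf_ball n) = real n \<and>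
            (\<forall>(M :: 'a measure) X. iid_sequence M (uniform_on_ball n) X \<longrightarrow>
               sufficient_size M X (coord_sum n) (linf_ball n) \<delta> p
                 (N_min M X (coord_sum n) (linf_ball n) \<delta> p) \<and>
               int (N_min M X (coord_sum n) (linf_ball n) \<delta> p) =
                 \<lceil>ln (1 - p) / ln (1 - real n ^ n * \<delta> ^ n / (2 ^ n * fact n))\<rceil>))
       \<and> (\<forall>p::real. 0 < p \<and> p < 1 \<longrightarrow>
            (\<exists>n0::nat. \<forall>n\<ge>n0. \<exists>\<delta>0>0. \<forall>\<delta>::real. 0 < \<delta> \<and> \<delta> < \<delta>0 \<longrightarrow>
               (\<forall>(M :: 'a measure) X. iid_sequence M (uniform_on_ball n) X \<longrightarrow>
                  real (N_min M X (coord_sum n) (linf_ball n) \<delta> p) >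
                    - (sqrt (2 * pi * real n) / (\<delta> * exp 1 / 2) ^ n) * ln (1 - p))))"
proof (intro conjI allI impI, goal_cases)
  case 1 show ?case by (rule true_max_coord_sum)
next
  case 2 then show ?case by (intro N_min_eq(1)) auto
next
  case 3 then show ?case by (intro N_min_eq(2)) auto
next
  case (4 p)
  \<comment> \<open>The bound already holds from \<open>n0 = 1\<close> on, for every
    \<open>p\<close>; only the threshold for \<delta> varies with \<open>n\<close>.\<close>
  then show ?case by (intro exI[of _ 1] allI impI N_min_lower_bound) auto
qed

end
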